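(* Let $b_0,b_1,b_2,\ldots$ be defined by the power series identity $$\sum_{i=0}^{\infty}b_i z^i=\frac{\sqrt z}{J_1(\sqrt{4z})},\qquad\text{where } \frac{J_1(\sqrt{4z})}{\sqrt z}=\sum_{m=0}^{\infty}\frac{(-1)^m}{m!\,(m+1)!}z^m,$$ and for integers $s\ge1$, $n\ge0$ put $$\alpha_n^{(s)}=(n-2s+1)\sum_{i=0}^{s}\frac{(-1)^{s-i}}{(s-i)!}\,b_i\,n^{\underline{s-1+i}}.$$ Let $\psi_{AF}:\mathbb{C}[x_0,x_1,x_2,\ldots]\to\mathbb{C}[x_0,x_1,x_2,\ldots]$ be the $\mathbb{C}$-algebra homomorphism with $$\psi_{AF}(x_n)=x_{n+1}+\sum_{i=1}^{\lfloor (n-1)/2\rfloor}\alpha_n^{(i)}x_{n+1-2i}\qquad(n\ge0),$$ (an empty sum being $0$). Then $\psi_{AF}$ is an Appel–Fibonacci intertwining map, i.e. $\psi_{AF}\circ\mathcal{D}_{\mathcal{A}}=\mathcal{D}_{\mathcal{F}}\circ\psi_{AF}$.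
   Context: $n^{\underline{a}}=n(n-1)\cdots(n-a+1)$ is the falling factorial ($n^{\underline 0}=1$). $\mathcal{D}_{\mathcal{A}}$ (Appel) and $\mathcal{D}_{\mathcal{F}}$ (Fibonacci) are the $\mathbb{C}$-linear derivations of $\mathbb{C}[x_0,x_1,x_2,\ldots]$ determined by $\mathcal{D}_{\mathcal{A}}(x_0)=0$, $\mathcal{D}_{\mathcal{A}}(x_n)=n x_{n-1}$ for $n\ge1$, and $\mathcal{D}_{\mathcal{F}}(x_0)=\mathcal{D}_{\mathcal{F}}(x_1)=0$, $\mathcal{D}_{\mathcal{F}}(x_n)=\sum_{k=0}^{\lfloor (n-1)/2\rfloor}(-1)^k(n-1-2k)\,x_{n-1-2k}$ for $n\ge2$. *)

theory Defs
  imports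
    Complex_Main
    "HOL-Library.Poly_Mapping"
    "HOL-Computational_Algebra.Formal_Power_Series"
begin

section \<open>The polynomial ring in countably many variables\<close>

text \<open>
  A monomial is its finitely supported exponent vector, and a polynomial is a finitely supported
  map from monomials to coefficients. Multiplication on \<^typ>\<open>'a \<Rightarrow>\<^sub>0 'b\<close> is convolution, so this is the
  polynomial ring over the complex numbers in the variables indexed by \<^typ>\<open>nat\<close>.
\<close>

type_synonym cpoly = "(nat \<Rightarrow>\<^sub>0 nat) \<Rightarrow>\<^sub>0 complex"

definition X :: "nat \<Rightarrow> cpoly" where
  "X n = Poly_Mapping.single (Poly_Mapping.single n 1) 1"

definition scale :: "complex \<Rightarrow> cpoly \<Rightarrow> cpoly" where
  "scale c p = Poly_Mapping.single 0 c * p"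

definition derivation :: "(cpoly \<Rightarrow> cpoly) \<Rightarrow> bool" where
  "derivation D \<longleftrightarrow>
     (\<forall>p q. D (p + q) = D p + D q) \<and>
     (\<forall>c p. D (scale c p) = scale c (D p)) \<and>
     (\<forall>p q. D (p * q) = D p * q + p * D q)"

definition algebra_hom :: "(cpoly \<Rightarrow> cpoly) \<Rightarrow> bool" where
  "algebra_hom h \<longleftrightarrow>
     (\<forall>p q. h (p + q) = h p + h q) \<and>
     (\<forall>c p. h (scale c p) = scale c (h p)) \<and>
     (\<forall>p q. h (p * q) = h p * h q) \<and>
     h 1 = 1"


section \<open>The coefficients\<close>

definition falling_factorial :: "nat \<Rightarrow> nat \<Rightarrow> complex" where
  "falling_factorial n a = (\<Prod>j<a. of_nat n - of_nat j)"

text \<open>The power series of \<open>J\<^sub>1(\<surd>(4z)) / \<surd>z\<close>.\<close>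

definition bessel_quotient :: "complex fps" where
  "bessel_quotient = Abs_fps (\<lambda>m. (-1) ^ m / (fact m * fact (m + 1)))"

definition b_coeff :: "nat \<Rightarrow> complex" where
  "b_coeff i = fps_nth (inverse bessel_quotient) i"

text \<open>The first factor is formed in the complex numbers, as \<open>n - 2s + 1\<close> may be negative.\<close>

definition alpha :: "nat \<Rightarrow> nat \<Rightarrow> complex" where
  "alpha s n = (of_nat n - 2 * of_nat s + 1) *
     (\<Sum>i=0..s. (-1) ^ (s - i) / fact (s - i) * b_coeff i * falling_factorial n (s - 1 + i))"

lemma b_series: "Abs_fps b_coeff * bessel_quotient = 1"
proof -
  have "Abs_fps b_coeff = inverse bessel_quotient"
    by (simp add: fps_eq_iff b_coeff_def)
  thus ?thesis
    by (simp add: inverse_mult_eq_1 bessel_quotient_def)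
qed


section \<open>Derivations and homomorphisms exist uniquely for prescribed values on the variables\<close>

abbreviation monom :: "(nat \<Rightarrow>\<^sub>0 nat) \<Rightarrow> cpoly" where
  "monom m \<equiv> Poly_Mapping.single m 1"

definition lin_ext :: "((nat \<Rightarrow>\<^sub>0 nat) \<Rightarrow> cpoly) \<Rightarrow> cpoly \<Rightarrow> cpoly" where
  "lin_ext F p = (\<Sum>m\<in>Poly_Mapping.keys p. scale (Poly_Mapping.lookup p m) (F m))"

lemma scale_0 [simp]: "scale 0 p = 0"
  by (simp add: scale_def)

lemma scale_1 [simp]: "scale 1 p = p"
  by (simp add: scale_def)

lemma scale_zero [simp]: "scale c 0 = 0"
  by (simp add: scale_def)

lemma scale_add: "scale (c + d) p = scale c p + scale d p"
  by (simp add: scale_def single_add distrib_right)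

lemma scale_scale: "scale c (scale d p) = scale (c * d) p"
  by (simp add: scale_def mult_single flip: mult.assoc)

lemma scale_monom: "scale c (monom m) = Poly_Mapping.single m c"
  by (simp add: scale_def mult_single)

lemma lin_ext_superset:
  assumes "finite A" "Poly_Mapping.keys p \<subseteq> A"
  shows "lin_ext F p = (\<Sum>m\<in>A. scale (Poly_Mapping.lookup p m) (F m))"
  unfolding lin_ext_def
  using assms by (intro sum.mono_neutral_left) (auto simp: in_keys_iff)

lemma lin_ext_add: "lin_ext F (p + q) = lin_ext F p + lin_ext F q"
proof -
  let ?A = "Poly_Mapping.keys p \<union> Poly_Mapping.keys q"
  show ?thesis
    using Poly_Mapping.keys_add [of p q]
    by (simp add: lin_ext_superset [of ?A] lookup_add scale_add sum.distrib)
qed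

lemma lin_ext_single: "lin_ext F (Poly_Mapping.single m c) = scale c (F m)"
  by (simp add: lin_ext_def)

lemma cpoly_induct [case_names zero add single]:
  fixes p :: cpoly
  assumes "P 0" "\<And>p q. P p \<Longrightarrow> P q \<Longrightarrow> P (p + q)" "\<And>m c. P (Poly_Mapping.single m c)"
  shows "P p"
proof (induction p rule: update_induct)
  case const
  thus ?case using assms(1) by simp
next
  case (update p m c)
  have "Poly_Mapping.update m c p = p + Poly_Mapping.single m c"
    using update.hyps
    by (intro poly_mapping_eqI) (auto simp: lookup_update lookup_add lookup_single in_keys_iff when_def)
  thus ?case using assms update by simp
qed

lemma lin_ext_scale: "lin_ext F (scale c p) = scale c (lin_ext F p)"
proof (induction p rule: cpoly_induct)
  case zero
  show ?case by (simp add: lin_ext_def)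
next
  case (add p q)
  thus ?case by (simp add: lin_ext_add scale_def distrib_left)
next
  case (single m d)
  have "scale c (Poly_Mapping.single m d) = Poly_Mapping.single m (c * d)"
    by (simp add: scale_def mult_single)
  thus ?case by (simp add: lin_ext_single scale_scale)
qed

lemma derivation_lin_ext:
  assumes "\<And>m n. F (m + n) = F m * monom n + monom m * F n"
  shows "derivation (lin_ext F)"
proof -
  have "lin_ext F (p * q) = lin_ext F p * q + p * lin_ext F q" for p q
  proof (induction p rule: cpoly_induct)
    case zero
    show ?case by (simp add: lin_ext_def)
  next
    case (add p p')
    thus ?case by (simp add: lin_ext_add algebra_simps)
  next
    case (single m c)
    show ?case
    proof (induction q rule: cpoly_induct)
      case zero
      show ?case by (simp add: lin_ext_def)
    next
      case (add p q)
      thus ?case by (simp add: lin_ext_add algebra_simps)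
    next
      case (single n d)
      have "lin_ext F (Poly_Mapping.single m c * Poly_Mapping.single n d)
          = scale (c * d) (F m * monom n + monom m * F n)"
        by (simp add: mult_single lin_ext_single assms)
      also have "\<dots> = scale c (F m) * scale d (monom n) + scale c (monom m) * scale d (F n)"
        by (simp add: scale_def algebra_simps mult_single [of 0 c 0 d, simplified, symmetric])
      finally show ?case by (simp add: scale_monom lin_ext_single)
    qed
  qed
  thus ?thesis by (simp add: derivation_def lin_ext_add lin_ext_scale)
qed

lemma algebra_hom_lin_ext:
  assumes "\<And>m n. F (m + n) = F m * F n" "F 0 = 1"
  shows "algebra_hom (lin_ext F)"
proof -
  have "lin_ext F (p * q) = lin_ext F p * lin_ext F q" for p q
  proof (induction p rule: cpoly_induct)
    case zero
    show ?case by (simp add: lin_ext_def)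
  next
    case (add p p')
    thus ?case by (simp add: lin_ext_add algebra_simps)
  next
    case (single m c)
    show ?case
    proof (induction q rule: cpoly_induct)
      case zero
      show ?case by (simp add: lin_ext_def)
    next
      case (add p q)
      thus ?case by (simp add: lin_ext_add algebra_simps)
    next
      case (single n d)
      have "lin_ext F (Poly_Mapping.single m c * Poly_Mapping.single n d) = scale (c * d) (F m * F n)"
        by (simp add: mult_single lin_ext_single assms)
      also have "\<dots> = scale c (F m) * scale d (F n)"
        by (simp add: scale_def algebra_simps mult_single [of 0 c 0 d, simplified, symmetric])
      finally show ?case by (simp add: lin_ext_single)
    qed
  qed
  moreover have "lin_ext F 1 = 1"
    using lin_ext_single [of F 0 1] assms(2) by simp
  ultimately show ?thesis by (simp add: algebra_hom_def lin_ext_add lin_ext_scale)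
qed

lemma ex_derivation: "\<exists>D. derivation D \<and> (\<forall>n. D (X n) = f n)"
proof -
  define G where "G m i = of_nat (Poly_Mapping.lookup m i) * f i * monom (m - Poly_Mapping.single i 1)"
    for m i
  define F where "F m = (\<Sum>i\<in>Poly_Mapping.keys m. G m i)" for m
  have F_superset: "F m = (\<Sum>i\<in>A. G m i)" if "finite A" "Poly_Mapping.keys m \<subseteq> A" for m A
    unfolding F_def using that
    by (intro sum.mono_neutral_left) (auto simp: in_keys_iff G_def)
  have G_left: "of_nat (Poly_Mapping.lookup m i) * f i * monom (m + n - Poly_Mapping.single i 1) = G m i * monom n"
    for m n i
  proof (cases "Poly_Mapping.lookup m i = 0")
    case False
    have "m + n - Poly_Mapping.single i 1 = (m - Poly_Mapping.single i 1) + n"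
      using False by (intro poly_mapping_eqI) (auto simp: lookup_add lookup_minus lookup_single when_def)
    thus ?thesis by (simp add: G_def mult_single mult.assoc)
  qed (simp add: G_def)
  have G_add: "G (m + n) i = G m i * monom n + monom m * G n i" for m n i
    using G_left [of m i n] G_left [of n i m]
    by (simp add: G_def [of "m + n"] lookup_add algebra_simps)
  have F_add: "F (m + n) = F m * monom n + monom m * F n" for m n
  proof -
    let ?A = "Poly_Mapping.keys m \<union> Poly_Mapping.keys n"
    have "F (m + n) = (\<Sum>i\<in>?A. G m i * monom n + monom m * G n i)"
      using Poly_Mapping.keys_add [of m n] by (simp add: F_superset [of ?A] G_add)
    also have "\<dots> = F m * monom n + monom m * F n"
      by (simp add: F_superset [of ?A] sum.distrib sum_distrib_left sum_distrib_right)
    finally show ?thesis .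
  qed
  have "lin_ext F (X n) = f n" for n
    by (simp add: X_def lin_ext_single F_def G_def)
  thus ?thesis using derivation_lin_ext [of F] F_add by blast
qed

lemma ex_algebra_hom: "\<exists>h. algebra_hom h \<and> (\<forall>n. h (X n) = f n)"
proof -
  define F where "F m = (\<Prod>i\<in>Poly_Mapping.keys m. f i ^ Poly_Mapping.lookup m i)" for m
  have F_superset: "F m = (\<Prod>i\<in>A. f i ^ Poly_Mapping.lookup m i)"
    if "finite A" "Poly_Mapping.keys m \<subseteq> A" for m A
    unfolding F_def using that
    by (intro prod.mono_neutral_left) (auto simp: in_keys_iff)
  have "F (m + n) = F m * F n" for m n
  proof -
    let ?A = "Poly_Mapping.keys m \<union> Poly_Mapping.keys n"
    show ?thesis
      using Poly_Mapping.keys_add [of m n]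
      by (simp add: F_superset [of ?A] lookup_add power_add prod.distrib)
  qed
  moreover have "F 0 = 1" by (simp add: F_def)
  moreover have "lin_ext F (X n) = f n" for n
    by (simp add: X_def lin_ext_single F_def)
  ultimately show ?thesis using algebra_hom_lin_ext [of F] by blast
qed

lemma cpoly_algebra_induct [case_names one var add mult scale]:
  fixes p :: cpoly
  assumes one: "P 1" and var: "\<And>n. P (X n)"
    and add: "\<And>p q. P p \<Longrightarrow> P q \<Longrightarrow> P (p + q)"
    and mult: "\<And>p q. P p \<Longrightarrow> P q \<Longrightarrow> P (p * q)"
    and scale: "\<And>c p. P p \<Longrightarrow> P (scale c p)"
  shows "P p"
proof -
  have power: "P (monom (Poly_Mapping.single i k))" for i k
  proof (induction k)
    case (Suc k)
    have "monom (Poly_Mapping.single i (Suc k)) = X i * monom (Poly_Mapping.single i k)"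
      by (simp add: X_def mult_single flip: single_add)
    thus ?case using Suc var mult by simp
  qed (simp add: one)
  have monom: "P (monom m)" for m
  proof (induction m rule: update_induct)
    case const
    thus ?case using one by simp
  next
    case (update m i k)
    have "Poly_Mapping.update i k m = m + Poly_Mapping.single i k"
      using update.hyps
      by (intro poly_mapping_eqI) (auto simp: lookup_update lookup_add lookup_single in_keys_iff when_def)
    hence "monom (Poly_Mapping.update i k m) = monom m * monom (Poly_Mapping.single i k)"
      by (simp add: mult_single)
    thus ?case using update mult power by simp
  qed
  show ?thesis
  proof (induction p rule: cpoly_induct)
    case zero
    show ?case using scale [OF one, of 0] by simp
  next
    case (single m c)
    show ?case using scale [OF monom, of c m] by (simp add: scale_monom)
  qed (rule add)
qed

lemma derivation_one: "derivation D \<Longrightarrow> D 1 = 0"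
  by (metis (no_types, lifting) derivation_def add_cancel_right_right mult_1 mult_1_right)

theorem ex1_derivation: "\<exists>!D. derivation D \<and> (\<forall>n. D (X n) = f n)"
proof (rule ex_ex1I [OF ex_derivation])
  fix D E assume D: "derivation D \<and> (\<forall>n. D (X n) = f n)" and E: "derivation E \<and> (\<forall>n. E (X n) = f n)"
  have "D p = E p" for p
    by (induction p rule: cpoly_algebra_induct)
       (use D E in \<open>auto simp: derivation_one\<close>, auto simp: derivation_def)
  thus "D = E" by blast
qed

theorem ex1_algebra_hom: "\<exists>!h. algebra_hom h \<and> (\<forall>n. h (X n) = f n)"
proof (rule ex_ex1I [OF ex_algebra_hom])
  fix g h assume g: "algebra_hom g \<and> (\<forall>n. g (X n) = f n)" and h: "algebra_hom h \<and> (\<forall>n. h (X n) = f n)"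
  have "g p = h p" for p
    by (induction p rule: cpoly_algebra_induct) (use g h in \<open>auto simp: algebra_hom_def\<close>)
  thus "g = h" by blast
qed

end

theory Submission
  imports Defs
begin

text \<open>
  Both \<open>\<psi>\<^sub>A\<^sub>F \<circ> D\<^sub>A\<close> and \<open>D\<^sub>F \<circ> \<psi>\<^sub>A\<^sub>F\<close> are derivations along the homomorphism \<open>\<psi>\<^sub>A\<^sub>F\<close>, so it is enough
  that they agree on the variables. With \<open>\<alpha>\<^sub>n\<^sup>(\<^sup>0\<^sup>) = 1\<close>, comparing the coefficients of \<open>x\<^sub>n\<^sub>-\<^sub>2\<^sub>j\<close> in
  the images of \<open>x\<^sub>n\<close> leaves the scalar identity
  \<open>n \<alpha>\<^sub>n\<^sub>-\<^sub>1\<^sup>(\<^sup>j\<^sup>) = (n - 2j) S\<^sub>n\<^sup>(\<^sup>j\<^sup>)\<close>, where \<open>S\<^sub>n\<^sup>(\<^sup>j\<^sup>) = \<Sum>\<^sub>i\<^sub>\<le>\<^sub>j (-1)\<^sup>j\<^sup>-\<^sup>i \<alpha>\<^sub>n\<^sup>(\<^sup>i\<^sup>)\<close>.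

  The alternating sum has the closed form \<open>\<Sum>\<^sub>i\<^sub>\<le>\<^sub>j (-1)\<^sup>j\<^sup>-\<^sup>i / (j-i)! b\<^sub>i n(n-1)\<cdots>(n-j-i+1)\<close>, called \<open>beta\<close>
  below. Indeed \<open>beta\<close> satisfies the recurrence \<open>\<beta>\<^sup>(\<^sup>s\<^sup>) + \<beta>\<^sup>(\<^sup>s\<^sup>-\<^sup>1\<^sup>) = \<alpha>\<^sup>(\<^sup>s\<^sup>)\<close> that determines
  alternating partial sums (\<open>beta_recurrence\<close>), because in each summand the two contributions
  \<open>n - s - i + 1\<close> and \<open>-(s - i)\<close> add up to the factor \<open>n - 2s + 1\<close> of \<open>\<alpha>\<close>. Pulling one factor
  \<open>n\<close> out of the falling factorials then gives the scalar identity (\<open>psi_coeff_eq_beta\<close>).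

  The Bessel function enters at the boundary: if \<open>n = 2j + 1\<close> with \<open>j > 0\<close> then
  \<open>\<psi>\<^sub>A\<^sub>F (x\<^sub>n\<^sub>-\<^sub>1)\<close> has no term in \<open>x\<^sub>1\<close>, so \<open>\<beta>\<close> has to vanish there. At this \<open>n\<close> the
  falling factorials are \<open>n! / (j+1-i)!\<close>, and \<open>\<beta>\<close> becomes \<open>n!\<close> times the \<open>j\<close>-th coefficient of
  the product of the Bessel quotient with its inverse (\<open>beta_boundary\<close>).
\<close>

lemma falling_factorial_Suc:
  "falling_factorial n (Suc a) = falling_factorial n a * (of_nat n - of_nat a)"
  by (simp add: falling_factorial_def)

lemma falling_factorial_Suc_Suc:
  "falling_factorial (Suc n) (Suc a) = of_nat (Suc n) * falling_factorial n a"
  unfolding falling_factorial_def by (subst prod.lessThan_Suc_shift) simp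

lemma falling_factorial_eq_fact_div:
  "falling_factorial (m + a) a = fact (m + a) / fact m"
proof (induction a)
  case 0
  show ?case by (simp add: falling_factorial_def)
next
  case (Suc a)
  thus ?case by (simp add: falling_factorial_Suc_Suc)
qed

lemma b_coeff_0: "b_coeff 0 = 1"
  by (simp add: b_coeff_def bessel_quotient_def)

text \<open>The alternating partial sums of \<^const>\<open>alpha\<close>, with first term 1, in closed form.\<close>

definition beta :: "nat \<Rightarrow> nat \<Rightarrow> complex" where
  "beta s n = (\<Sum>i\<le>s. (-1) ^ (s - i) / fact (s - i) * b_coeff i * falling_factorial n (s + i))"

lemma beta_0: "beta 0 n = 1"
  by (simp add: beta_def b_coeff_0 falling_factorial_def)

text \<open>
  One factor \<open>n - s - i\<close> split off the falling factorial, and the factor \<open>s + 1 - i\<close> by which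
  consecutive factorials differ, turn both sums into combinations of the summands of \<open>alpha (s + 1)\<close>.
\<close>

lemma beta_recurrence: "beta (Suc s) n + beta s n = alpha (Suc s) n"
proof -
  let ?c = "\<lambda>i. (-1) ^ (Suc s - i) / fact (Suc s - i) * b_coeff i * falling_factorial n (s + i)"
  have "beta (Suc s) n = (\<Sum>i\<le>Suc s. (of_nat n - of_nat (s + i)) * ?c i)"
    unfolding beta_def by (intro sum.cong refl) (simp add: falling_factorial_Suc)
  (* the added summand for i = Suc s has the factor 0, so both sums can share one range *)
  moreover have "beta s n = (\<Sum>i\<le>Suc s. - of_nat (Suc s - i) * ?c i)"
  proof -
    have "(-1) ^ (s - i) / fact (s - i)
        = - of_nat (Suc s - i) * ((-1) ^ (Suc s - i) / fact (Suc s - i) :: complex)" if "i \<le> s" for i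
      using that by (simp add: Suc_diff_le del: of_nat_Suc)
    hence "beta s n = (\<Sum>i\<le>s. - of_nat (Suc s - i) * ?c i)"
      unfolding beta_def by (intro sum.cong refl) (simp only: atMost_iff mult.assoc)
    thus ?thesis by simp
  qed
  ultimately have "beta (Suc s) n + beta s n
      = (\<Sum>i\<le>Suc s. (of_nat n - of_nat (s + i)) * ?c i + - of_nat (Suc s - i) * ?c i)"
    by (simp only: sum.distrib)
  also have "\<dots> = (\<Sum>i\<le>Suc s. (of_nat n - 2 * of_nat (Suc s) + 1) * ?c i)"
    unfolding distrib_right [symmetric]
    by (intro sum.cong refl arg_cong2 [where f = "(*)"]) (simp add: of_nat_diff)
  also have "\<dots> = alpha (Suc s) n"
    unfolding sum_distrib_left [symmetric]
    by (simp add: alpha_def atLeast0AtMost del: sum.atMost_Suc)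
  finally show ?thesis .
qed

text \<open>
  The formula for \<^const>\<open>alpha\<close> at \<open>s = 0\<close> would need the falling factorial of length \<open>-1\<close>, with value
  \<open>1/(n+1)\<close>; truncated subtraction gives \<open>n + 1\<close> in place of 1, so the leading coefficient is set by hand.
\<close>

definition psi_coeff :: "nat \<Rightarrow> nat \<Rightarrow> complex" where
  "psi_coeff s n = (if s = 0 then 1 else alpha s n)"

lemma alternating_sum_psi_coeff:
  "(\<Sum>i\<le>j. (-1) ^ (j - i) * psi_coeff i n) = beta j n"
proof (induction j)
  case 0
  show ?case by (simp add: beta_0 psi_coeff_def)
next
  case (Suc j)
  have "(\<Sum>i\<le>j. (-1) ^ (Suc j - i) * psi_coeff i n) = - (\<Sum>i\<le>j. (-1) ^ (j - i) * psi_coeff i n)"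
    by (simp add: Suc_diff_le sum_negf)
  thus ?case
    using beta_recurrence [of j n] Suc.IH by (simp add: psi_coeff_def algebra_simps)
qed

text \<open>
  The coefficients of \<open>x\<^sub>n\<^sub>+\<^sub>1\<^sub>-\<^sub>2\<^sub>j\<close> in the images of \<open>x\<^sub>n\<^sub>+\<^sub>1\<close> under the two composites: the
  first factor of \<open>alpha j n\<close> is \<open>n + 1 - 2j\<close>, the weight that the Fibonacci derivation attaches to
  this variable, and the factor \<open>n + 1\<close> lengthens every falling factorial by one.
\<close>

lemma psi_coeff_eq_beta:
  "of_nat (Suc n) * psi_coeff j n = (of_nat (Suc n) - 2 * of_nat j) * beta j (Suc n)"
proof (cases j)
  case 0
  thus ?thesis by (simp add: psi_coeff_def beta_0)
next
  case (Suc s)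
  let ?S = "\<Sum>i\<le>j. (-1) ^ (j - i) / fact (j - i) * b_coeff i * falling_factorial n (j - 1 + i)"
  have "beta j (Suc n) = of_nat (Suc n) * ?S"
    unfolding beta_def sum_distrib_left
    using Suc by (intro sum.cong refl) (simp add: falling_factorial_Suc_Suc del: of_nat_Suc)
  moreover have "psi_coeff j n = (of_nat (Suc n) - 2 * of_nat j) * ?S"
    using Suc by (simp add: psi_coeff_def alpha_def atLeast0AtMost add.commute)
  ultimately show ?thesis by (simp only: mult.left_commute)
qed

text \<open>
  Since \<open>2j + 1 - (j + i) = j - i + 1\<close>, the falling factorial supplies exactly the second factorial in
  the coefficients of the Bessel quotient, and a series times its inverse has no terms of positive degree.
\<close>

lemma beta_boundary:
  assumes "j > 0"
  shows "beta j (2 * j + 1) = 0"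
proof -
  have ff: "falling_factorial (2 * j + 1) (j + i) = fact (2 * j + 1) / fact (j - i + 1)" if "i \<le> j" for i
    using falling_factorial_eq_fact_div [of "j - i + 1" "j + i"] that
    by (simp add: mult_2 del: fact_Suc)
  have "beta j (2 * j + 1)
      = fact (2 * j + 1) * (\<Sum>i\<le>j. b_coeff i * ((-1) ^ (j - i) / (fact (j - i) * fact (j - i + 1))))"
    unfolding beta_def sum_distrib_left
    by (intro sum.cong refl) (simp only: ff atMost_iff, simp add: field_simps)
  also have "(\<Sum>i\<le>j. b_coeff i * ((-1) ^ (j - i) / (fact (j - i) * fact (j - i + 1))))
      = fps_nth (Abs_fps b_coeff * bessel_quotient) j"
    by (simp add: fps_mult_nth bessel_quotient_def atLeast0AtMost)
  also have "\<dots> = 0"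
    using assms by (simp add: b_series)
  finally show ?thesis by simp
qed

lemma scale_sum: "scale (\<Sum>i\<in>A. f i) p = (\<Sum>i\<in>A. scale (f i) p)"
  by (induction A rule: infinite_finite_induct) (simp_all add: scale_add)

lemma scale_sum_right: "scale c (\<Sum>i\<in>A. f i) = (\<Sum>i\<in>A. scale c (f i))"
  by (simp add: scale_def sum_distrib_left)

lemma derivation_zero: "derivation D \<Longrightarrow> D 0 = 0"
  by (metis derivation_def scale_0)

lemma derivation_lincomb:
  assumes "derivation D"
  shows "D (\<Sum>i\<in>A. scale (c i) (p i)) = (\<Sum>i\<in>A. scale (c i) (D (p i)))"
  using assms
  by (induction A rule: infinite_finite_induct) (simp_all add: derivation_zero, simp_all add: derivation_def)

text \<open>
  Replacing \<open>i + k\<close> by \<open>j\<close> in the double sum collects all contributions to one variable, with the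
  alternating sum of the coefficients of the homomorphism as its coefficient.
\<close>

lemma fibonacci_lincomb:
  assumes D: "derivation D"
    and D_X: "\<And>m. m \<ge> 2 \<Longrightarrow> D (X m) = (\<Sum>k=0..(m - 1) div 2.
             scale ((-1) ^ k * of_nat (m - 1 - 2 * k)) (X (m - 1 - 2 * k)))"
    and "n \<ge> 1"
  defines "N \<equiv> (n - 1) div 2"
  shows "D (\<Sum>i\<le>N. scale (c i) (X (n + 1 - 2 * i)))
       = (\<Sum>j\<le>N. scale (of_nat (n - 2 * j) * (\<Sum>i\<le>j. (-1) ^ (j - i) * c i)) (X (n - 2 * j)))"
proof -
  let ?f = "\<lambda>i k. scale (c i * ((-1) ^ k * of_nat (n - 2 * (i + k)))) (X (n - 2 * (i + k)))"
  have D_term: "scale (c i) (D (X (n + 1 - 2 * i))) = (\<Sum>k\<le>N - i. ?f i k)" if "i \<le> N" for i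
  proof -
    have "n - 2 * i \<ge> 1"
      using that \<open>n \<ge> 1\<close> unfolding N_def by linarith
    hence "scale (c i) (D (X (n + 1 - 2 * i))) = (\<Sum>k=0..(n - 2 * i) div 2. ?f i k)"
      by (subst D_X) (auto simp: scale_sum_right scale_scale algebra_simps)
    (* for even n the range of k is one longer than N - i, but its last coefficient is 0 *)
    also have "\<dots> = (\<Sum>k\<le>N - i. ?f i k)"
    proof (rule sum.mono_neutral_right)
      show "{..N - i} \<subseteq> {0..(n - 2 * i) div 2}"
        using \<open>n - 2 * i \<ge> 1\<close> unfolding N_def by auto
      show "\<forall>k\<in>{0..(n - 2 * i) div 2} - {..N - i}. ?f i k = 0"
      proof
        fix k assume "k \<in> {0..(n - 2 * i) div 2} - {..N - i}"
        hence "n - 2 * (i + k) = 0"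
          unfolding N_def by simp linarith
        thus "?f i k = 0" by simp
      qed
    qed simp
    finally show ?thesis .
  qed
  have "D (\<Sum>i\<le>N. scale (c i) (X (n + 1 - 2 * i))) = (\<Sum>i\<le>N. \<Sum>k\<le>N - i. ?f i k)"
    unfolding derivation_lincomb [OF D] by (intro sum.cong refl D_term) simp
  also have "\<dots> = (\<Sum>(i, k)\<in>{(i, k). i + k \<le> N}. ?f i k)"
    by (subst sum.Sigma) (auto intro!: sum.cong)
  also have "\<dots> = (\<Sum>j\<le>N. \<Sum>i\<le>j. ?f i (j - i))"
    by (rule sum.triangle_reindex_eq)
  also have "\<dots> = (\<Sum>j\<le>N. scale (of_nat (n - 2 * j) * (\<Sum>i\<le>j. (-1) ^ (j - i) * c i)) (X (n - 2 * j)))"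
    by (intro sum.cong refl) (auto intro!: sum.cong simp: scale_sum sum_distrib_left mult_ac)
  finally show ?thesis .
qed

theorem theorem3p2:
  fixes D_A D_F \<psi>_AF :: "cpoly \<Rightarrow> cpoly"
  assumes "derivation D_A"
    and "D_A (X 0) = 0"
    and "\<And>n. n \<ge> 1 \<Longrightarrow> D_A (X n) = scale (of_nat n) (X (n - 1))"
    and "derivation D_F"
    and "D_F (X 0) = 0"
    and "D_F (X 1) = 0"
    and "\<And>n. n \<ge> 2 \<Longrightarrow>
           D_F (X n) = (\<Sum>k=0..(n - 1) div 2.
             scale ((-1) ^ k * of_nat (n - 1 - 2 * k)) (X (n - 1 - 2 * k)))"
    and "algebra_hom \<psi>_AF"
    and "\<And>n. \<psi>_AF (X n) =
           X (n + 1) + (\<Sum>i=1..(n - 1) div 2. scale (alpha i n) (X (n + 1 - 2 * i)))"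
  shows "\<psi>_AF \<circ> D_A = D_F \<circ> \<psi>_AF"
proof -
  note D_A = assms(1-3) and D_F = assms(4,7) and psi = assms(8)
  have psi_X: "\<psi>_AF (X n) = (\<Sum>i\<le>(n - 1) div 2. scale (psi_coeff i n) (X (n + 1 - 2 * i)))" for n
    by (simp add: assms(9) psi_coeff_def sum.atMost_shift sum.atLeast1_atMost_eq lessThan_Suc_atMost)
  have variable: "\<psi>_AF (D_A (X n)) = D_F (\<psi>_AF (X n))" for n
  proof (cases n)
    case 0
    have "\<psi>_AF 0 = 0"
      using psi by (metis algebra_hom_def scale_0)
    thus ?thesis
      using 0 assms(2,6) by (simp add: psi_X psi_coeff_def)
  next
    case (Suc m)
    let ?f = "\<lambda>j. scale (of_nat n * psi_coeff j m) (X (n - 2 * j))"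
    have "D_F (\<psi>_AF (X n)) = (\<Sum>j\<le>(n - 1) div 2. scale (of_nat (n - 2 * j) * beta j n) (X (n - 2 * j)))"
      unfolding psi_X using Suc by (subst fibonacci_lincomb [OF D_F]) (auto simp: alternating_sum_psi_coeff)
    also have "\<dots> = (\<Sum>j\<le>(n - 1) div 2. ?f j)"
      using Suc by (intro sum.cong refl) (auto simp: psi_coeff_eq_beta of_nat_diff simp del: of_nat_Suc)
    (* for odd n > 1 the last summand is the term in X 1, which is absent from the image of X m *)
    also have "\<dots> = (\<Sum>j\<le>(m - 1) div 2. ?f j)"
    proof (rule sum.mono_neutral_right)
      show "\<forall>j\<in>{..(n - 1) div 2} - {..(m - 1) div 2}. ?f j = 0"
      proof
        fix j assume "j \<in> {..(n - 1) div 2} - {..(m - 1) div 2}"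
        hence "n = 2 * j + 1" "j > 0"
          using Suc by auto
        hence "of_nat n * psi_coeff j m = 0"
          using beta_boundary [of j] psi_coeff_eq_beta [of m j] Suc by simp
        thus "?f j = 0" by (simp only: scale_0)
      qed
    qed (use Suc in auto)
    also have "\<dots> = scale (of_nat n) (\<psi>_AF (X m))"
      using Suc by (simp add: psi_X scale_sum_right scale_scale)
    also have "\<dots> = \<psi>_AF (D_A (X n))"
      using Suc D_A(3) [of n] psi by (simp add: algebra_hom_def)
    finally show ?thesis by simp
  qed
  have "\<psi>_AF (D_A p) = D_F (\<psi>_AF p)" for p
  proof (induction p rule: cpoly_algebra_induct)
    case one
    show ?case
      using psi derivation_one [OF D_A(1)] derivation_one [OF D_F(1)]
      by (metis algebra_hom_def scale_0)
  next
    case (var n)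
    show ?case by (rule variable)
  qed (use D_A(1) D_F(1) psi in \<open>simp_all add: derivation_def algebra_hom_def\<close>)
  thus ?thesis by auto
qed

end
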